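(* Let $V$ be a finite-dimensional vector space and let $\mathcal{X}=(X_i : i\in I)$ be a finite family of subspaces of $V$. Then the set of partial $q$-transversals of $\mathcal{X}$ is exactly the set of independent subspaces of some $q$-matroid on $V$.
   Context: A $q$-matroid on $V$ is given by a rank function $r$ on subspaces of $V$ with $0\le r(A)\le\dim A$, $A\le B\Rightarrow r(A)\le r(B)$, and $r(A+B)+r(A\cap B)\le r(A)+r(B)$; a subspace $A$ is independent if $r(A)=\dim A$. For a family of sets $(Y_i: i\in I)$, a set of vectors $B$ is a partial avoiding transversal if there is an injection $\pi:B\to I$ with $b\notin Y_{\pi(b)}$ for all $b\in B$. A partial $q$-transversal of $\mathcal{X}$ is a subspace $T\le V$ such that every vector basis of $T$ is a partial avoiding transversal of $\mathcal{X}$. *)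

theory Defs
  imports Complex_Main
begin

definition partial_avoiding_transversal ::
  "'i set \<Rightarrow> ('i \<Rightarrow> 'b set) \<Rightarrow> 'b set \<Rightarrow> bool" where
  "partial_avoiding_transversal I Y B \<longleftrightarrow>
     (\<exists>\<pi>. inj_on \<pi> B \<and> \<pi> ` B \<subseteq> I \<and> (\<forall>b\<in>B. b \<notin> Y (\<pi> b)))"

text \<open>The ground space is the whole type \<open>'b\<close>, with scalar multiplication \<open>scale\<close>.\<close>

definition vector_basis_of ::
  "('a::field \<Rightarrow> 'b::ab_group_add \<Rightarrow> 'b) \<Rightarrow> 'b set \<Rightarrow> 'b set \<Rightarrow> bool" where
  "vector_basis_of scale B T \<longleftrightarrow> \<not> module.dependent scale B \<and> module.span scale B = T"

definition partial_q_transversal ::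
  "('a::field \<Rightarrow> 'b::ab_group_add \<Rightarrow> 'b) \<Rightarrow> 'i set \<Rightarrow> ('i \<Rightarrow> 'b set) \<Rightarrow> 'b set \<Rightarrow> bool" where
  "partial_q_transversal scale I X T \<longleftrightarrow>
     module.subspace scale T \<and>
     (\<forall>B. vector_basis_of scale B T \<longrightarrow> partial_avoiding_transversal I X B)"

text \<open>Only the values of the rank function on subspaces are relevant, and \<open>0 \<le> r A\<close>
  holds by typing.\<close>

definition q_matroid ::
  "('a::field \<Rightarrow> 'b::ab_group_add \<Rightarrow> 'b) \<Rightarrow> ('b set \<Rightarrow> nat) \<Rightarrow> bool" where
  "q_matroid scale r \<longleftrightarrow>
     (\<forall>A. module.subspace scale A \<longrightarrow> r A \<le> vector_space.dim scale A) \<and>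
     (\<forall>A B. module.subspace scale A \<longrightarrow> module.subspace scale B \<longrightarrow> A \<subseteq> B \<longrightarrow> r A \<le> r B) \<and>
     (\<forall>A B. module.subspace scale A \<longrightarrow> module.subspace scale B \<longrightarrow>
        r {a + b | a b. a \<in> A \<and> b \<in> B} + r (A \<inter> B) \<le> r A + r B)"

definition q_independent ::
  "('a::field \<Rightarrow> 'b::ab_group_add \<Rightarrow> 'b) \<Rightarrow> ('b set \<Rightarrow> nat) \<Rightarrow> 'b set \<Rightarrow> bool" where
  "q_independent scale r A \<longleftrightarrow> module.subspace scale A \<and> r A = vector_space.dim scale A"

end

theory Submission imports Defs begin

text \<open>
  For a subspace \<open>U\<close> let \<open>f U\<close> be the number of \<open>i \<in> I\<close> with \<open>\<not> U \<subseteq> X i\<close>. As \<open>S \<subseteq> X i\<close> holds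
  iff \<open>span S \<subseteq> X i\<close>, and as every subspace of \<open>T\<close> is spanned by a part of some basis of \<open>T\<close>,
  applying Hall's marriage theorem to all bases of \<open>T\<close> shows that \<open>T\<close> is a partial
  \<open>q\<close>-transversal iff \<open>dim U \<le> f U\<close> for all \<open>U \<le> T\<close>. The function \<open>f\<close> is monotone and submodular
  and vanishes at the zero space, and for every such \<open>f\<close> the minimum of \<open>f U + dim A - dim U\<close>
  over \<open>U \<le> A\<close> is the rank function of a \<open>q\<close>-matroid whose independent spaces are those
  satisfying this inequality.
\<close>

section \<open>Hall's marriage theorem and avoiding transversals\<close>

theorem hall_marriage:
  assumes "finite B" and "\<And>b. b \<in> B \<Longrightarrow> finite (N b)"
    and "\<And>S. S \<subseteq> B \<Longrightarrow> card S \<le> card (\<Union>(N ` S))"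
  shows "\<exists>\<pi>. inj_on \<pi> B \<and> (\<forall>b\<in>B. \<pi> b \<in> N b)"
  using assms
proof (induction B arbitrary: N rule: finite_psubset_induct)
  case (psubset B)
  note fin = psubset.prems(1) and hall = psubset.prems(2)
  show ?case
  \<comment> \<open>The split is on a tight set: a nonempty proper \<open>S\<close> with exactly
    \<open>card S\<close> neighbours. If there is one, \<open>S\<close> and \<open>B - S\<close> are
    matched separately; otherwise every nonempty proper subset has a neighbour to spare.\<close>
  proof (cases "\<exists>S. S \<subset> B \<and> S \<noteq> {} \<and> card (\<Union>(N ` S)) = card S")
    case True
    then obtain S where S: "S \<subset> B" "card (\<Union>(N ` S)) = card S" "S \<noteq> {}"
      by blast
    have finS: "finite S"
      using S(1) psubset.hyps by (auto intro: finite_subset)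
    obtain f where f: "inj_on f S" "\<And>b. b \<in> S \<Longrightarrow> f b \<in> N b"
    proof -
      have "\<exists>f. inj_on f S \<and> (\<forall>b\<in>S. f b \<in> N b)"
      proof (rule psubset.IH[OF S(1)])
        show "finite (N b)" if "b \<in> S" for b using that S(1) fin by auto
        show "card K \<le> card (\<Union>(N ` K))" if "K \<subseteq> S" for K using that S(1) hall by simp
      qed
      then show thesis using that by blast
    qed
    \<comment> \<open>Deleting the neighbours of \<open>S\<close> keeps the two matchings disjoint.
      Hall's condition survives on \<open>B - S\<close>: apply it to \<open>K \<union> S\<close> and
      subtract the \<open>card S\<close> neighbours of the tight set.\<close>
    let ?N = "\<lambda>b. N b - \<Union>(N ` S)"
    have "\<exists>g. inj_on g (B - S) \<and> (\<forall>b\<in>B - S. g b \<in> ?N b)"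
    proof (rule psubset.IH)
      show "B - S \<subset> B" using S by blast
      show "finite (?N b)" if "b \<in> B - S" for b using that fin by auto
      show "card K \<le> card (\<Union>(?N ` K))" if K: "K \<subseteq> B - S" for K
      proof -
        have "finite K" using K psubset.hyps by (auto intro: finite_subset)
        then have "card K + card S = card (K \<union> S)"
          using K finS by (subst card_Un_disjoint) auto
        also have "\<dots> \<le> card (\<Union>(N ` (K \<union> S)))"
          using K S(1) by (intro hall) auto
        also have "\<Union>(N ` (K \<union> S)) = \<Union>(?N ` K) \<union> \<Union>(N ` S)"
          by auto
        also have "card \<dots> \<le> card (\<Union>(?N ` K)) + card S"
          using card_Un_le S(2) by metis
        finally show ?thesis by simp
      qed
    qed
    then obtain g where g: "inj_on g (B - S)" "\<And>b. b \<in> B - S \<Longrightarrow> g b \<in> ?N b"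
      by blast
    define h where "h b = (if b \<in> S then f b else g b)" for b
    have "inj_on h (S \<union> (B - S))"
      unfolding inj_on_Un
    proof (intro conjI)
      show "inj_on h S" using f(1) by (simp add: h_def inj_on_def)
      show "inj_on h (B - S)" using g(1) by (simp add: h_def inj_on_def)
      show "h ` (S - (B - S)) \<inter> h ` (B - S - S) = {}"
        using f(2) g(2) by (fastforce simp: h_def)
    qed
    moreover have "S \<union> (B - S) = B" using S(1) by blast
    moreover have "h b \<in> N b" if "b \<in> B" for b
      using f(2) g(2) that by (auto simp: h_def)
    ultimately show ?thesis by auto
  next
    case False
    show ?thesis
    proof (cases "B = {}")
      case nonempty: False
      then obtain b where b: "b \<in> B" by blast
      have "card {b} \<le> card (\<Union>(N ` {b}))"
        using b by (intro hall) auto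
      then obtain x where x: "x \<in> N b"
        by fastforce
      \<comment> \<open>Once \<open>b\<close> is matched to \<open>x\<close>, each remaining set
        loses at most one neighbour, and with no tight sets it can afford that.\<close>
      let ?N = "\<lambda>c. N c - {x}"
      have "\<exists>g. inj_on g (B - {b}) \<and> (\<forall>c\<in>B - {b}. g c \<in> ?N c)"
      proof (rule psubset.IH)
        show "B - {b} \<subset> B" using b by blast
        show "finite (?N c)" if "c \<in> B - {b}" for c using that fin by auto
        show "card K \<le> card (\<Union>(?N ` K))" if K: "K \<subseteq> B - {b}" for K
        proof (cases "K = {}")
          case ne: False
          have "card K \<le> card (\<Union>(N ` K))" using K by (intro hall) auto
          moreover have "card (\<Union>(N ` K)) \<noteq> card K"
            using False ne K b by blast
          moreover have "\<Union>(?N ` K) = \<Union>(N ` K) - {x}" by auto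
          ultimately show ?thesis
            by (auto simp: card_Diff_singleton_if)
        qed simp
      qed
      then obtain g where g: "inj_on g (B - {b})" "\<And>c. c \<in> B - {b} \<Longrightarrow> g c \<in> ?N c"
        by blast
      have "inj_on (g(b := x)) (insert b (B - {b}))"
        unfolding inj_on_insert using g by (auto simp: inj_on_def)
      then have "inj_on (g(b := x)) B" using b by (simp add: insert_absorb)
      moreover have "(g(b := x)) c \<in> N c" if "c \<in> B" for c
        using g(2) x that by auto
      ultimately show ?thesis by blast
    qed simp
  qed
qed

text \<open>Take the indices that \<open>b\<close> avoids as its neighbours. An index is then a
  neighbour of some element of \<open>S\<close> exactly when its member of the family does not
  contain \<open>S\<close>.\<close>

lemma partial_avoiding_transversal_iff_hall:
  assumes "finite I" and "finite B"
  shows "partial_avoiding_transversal I Y B \<longleftrightarrow>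
    (\<forall>S\<subseteq>B. card S \<le> card {i \<in> I. \<not> S \<subseteq> Y i})"
proof
  assume "partial_avoiding_transversal I Y B"
  then obtain \<pi> where \<pi>: "inj_on \<pi> B" "\<pi> ` B \<subseteq> I" "\<And>b. b \<in> B \<Longrightarrow> b \<notin> Y (\<pi> b)"
    unfolding partial_avoiding_transversal_def by blast
  show "\<forall>S\<subseteq>B. card S \<le> card {i \<in> I. \<not> S \<subseteq> Y i}"
  proof (intro allI impI)
    fix S assume S: "S \<subseteq> B"
    show "card S \<le> card {i \<in> I. \<not> S \<subseteq> Y i}"
      by (rule card_inj_on_le[of \<pi>]) (use S \<pi> assms(1) in \<open>auto intro: inj_on_subset\<close>)
  qed
next
  assume hall: "\<forall>S\<subseteq>B. card S \<le> card {i \<in> I. \<not> S \<subseteq> Y i}"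
  have "\<exists>\<pi>. inj_on \<pi> B \<and> (\<forall>b\<in>B. \<pi> b \<in> {i \<in> I. b \<notin> Y i})"
  proof (rule hall_marriage)
    fix S assume S: "S \<subseteq> B"
    have "(\<Union>b\<in>S. {i \<in> I. b \<notin> Y i}) = {i \<in> I. \<not> S \<subseteq> Y i}" by blast
    with hall S show "card S \<le> card (\<Union>b\<in>S. {i \<in> I. b \<notin> Y i})" by simp
  qed (use assms in auto)
  then show "partial_avoiding_transversal I Y B"
    unfolding partial_avoiding_transversal_def by fast
qed

section \<open>From bases to a dimension condition on subspaces\<close>

context finite_dimensional_vector_space
begin

text \<open>One direction needs a single suitable basis of \<open>T\<close> for each
  \<open>U\<close>; the other tests a part \<open>S\<close> of an arbitrary basis through the
  subspace \<open>span S\<close>.\<close>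

lemma partial_q_transversal_iff:
  assumes I: "finite I" and X: "\<And>i. i \<in> I \<Longrightarrow> subspace (X i)" and T: "subspace T"
  shows "partial_q_transversal scale I X T \<longleftrightarrow>
    (\<forall>U. subspace U \<longrightarrow> U \<subseteq> T \<longrightarrow> dim U \<le> card {i \<in> I. \<not> U \<subseteq> X i})"
proof
  assume trans: "partial_q_transversal scale I X T"
  show "\<forall>U. subspace U \<longrightarrow> U \<subseteq> T \<longrightarrow> dim U \<le> card {i \<in> I. \<not> U \<subseteq> X i}"
  proof (intro allI impI)
    fix U assume U: "subspace U" "U \<subseteq> T"
    obtain S where S: "S \<subseteq> U" "independent S" "U \<subseteq> span S" "card S = dim U"
      by (rule basis_exists)
    \<comment> \<open>A basis of \<open>U\<close> is extended to one of \<open>T\<close>, so that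
      Hall's condition for \<open>B\<close> can be read off at \<open>S\<close>.\<close>
    obtain B where B: "S \<subseteq> B" "B \<subseteq> T" "independent B" "T \<subseteq> span B"
      using maximal_independent_subset_extend[of S T] S U by blast
    have "span B = T"
      using B T by (simp add: span_minimal subset_antisym)
    then have "partial_avoiding_transversal I X B"
      using trans B(3) by (simp add: partial_q_transversal_def vector_basis_of_def)
    then have "card S \<le> card {i \<in> I. \<not> S \<subseteq> X i}"
      using partial_avoiding_transversal_iff_hall[OF I finiteI_independent[OF B(3)]] B(1) by blast
    also have "\<dots> \<le> card {i \<in> I. \<not> U \<subseteq> X i}"
      using S(1) I by (intro card_mono) auto
    finally show "dim U \<le> card {i \<in> I. \<not> U \<subseteq> X i}"
      using S(4) by simp
  qed
next
  assume R: "\<forall>U. subspace U \<longrightarrow> U \<subseteq> T \<longrightarrow> dim U \<le> card {i \<in> I. \<not> U \<subseteq> X i}"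
  have "partial_avoiding_transversal I X B" if B: "independent B" "span B = T" for B
    unfolding partial_avoiding_transversal_iff_hall[OF I finiteI_independent[OF B(1)]]
  proof (intro allI impI)
    fix S assume S: "S \<subseteq> B"
    have "card S = dim (span S)"
      using B(1) S by (simp add: dim_eq_card_independent independent_mono)
    also have "\<dots> \<le> card {i \<in> I. \<not> span S \<subseteq> X i}"
      using R subspace_span span_mono[OF S] unfolding B(2) by metis
    \<comment> \<open>Here the members of the family must be subspaces: they contain
      \<open>S\<close> iff they contain its span.\<close>
    also have "{i \<in> I. \<not> span S \<subseteq> X i} = {i \<in> I. \<not> S \<subseteq> X i}"
      using X span_minimal[of S] span_superset[of S] by (auto dest: subset_trans)
    finally show "card S \<le> card {i \<in> I. \<not> S \<subseteq> X i}" .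
  qed
  then show "partial_q_transversal scale I X T"
    using T by (simp add: partial_q_transversal_def vector_basis_of_def)
qed

text \<open>If \<open>X i\<close> contains \<open>A\<close> and \<open>B\<close>, it contains their
  sum; if it fails to contain \<open>A \<inter> B\<close>, it contains neither. So the two index
  sets on the left lie in the union and the intersection of those on the right.\<close>

lemma card_not_subset_submodular:
  assumes I: "finite I" and X: "\<And>i. i \<in> I \<Longrightarrow> subspace (X i)"
    and A: "subspace A" and B: "subspace B"
  shows "card {i \<in> I. \<not> {a + b | a b. a \<in> A \<and> b \<in> B} \<subseteq> X i} + card {i \<in> I. \<not> A \<inter> B \<subseteq> X i}
    \<le> card {i \<in> I. \<not> A \<subseteq> X i} + card {i \<in> I. \<not> B \<subseteq> X i}"
    (is "card ?S + card ?M \<le> card ?A + card ?B")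
proof -
  have "?S \<subseteq> ?A \<union> ?B"
    using subspace_add[OF X] by blast
  then have "card ?S \<le> card (?A \<union> ?B)"
    using I by (intro card_mono) auto
  moreover have "card ?M \<le> card (?A \<inter> ?B)"
    using I by (intro card_mono) auto
  moreover have "card ?A + card ?B = card (?A \<union> ?B) + card (?A \<inter> ?B)"
    using I by (intro card_Un_Int) auto
  ultimately show ?thesis by linarith
qed

section \<open>The q-matroid of a submodular function\<close>

text \<open>The q-analogue of the rank formula for the matroid induced by a submodular function. On
  a subspace \<open>A\<close> the infimum is a minimum, and the natural subtraction is exact since
  \<open>U \<subseteq> A\<close>.\<close>

definition submodular_rank :: "('b set \<Rightarrow> nat) \<Rightarrow> 'b set \<Rightarrow> nat" where
  "submodular_rank f A = (INF U\<in>{U. subspace U \<and> U \<subseteq> A}. f U + (dim A - dim U))"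

text \<open>Moving \<open>dim U\<close> to the left avoids truncated subtraction and keeps the later
  estimates linear.\<close>

lemma submodular_rank_le:
  assumes "subspace U" "U \<subseteq> A"
  shows "submodular_rank f A + dim U \<le> f U + dim A"
proof -
  have "submodular_rank f A \<le> f U + (dim A - dim U)"
    unfolding submodular_rank_def using assms by (intro cINF_lower) auto
  then show ?thesis using dim_subset[OF assms(2)] by linarith
qed

lemma submodular_rank_attained:
  assumes "subspace A"
  obtains U where "subspace U" "U \<subseteq> A" "submodular_rank f A + dim U = f U + dim A"
proof -
  let ?K = "(\<lambda>U. f U + (dim A - dim U)) ` {U. subspace U \<and> U \<subseteq> A}"
  have "Inf ?K \<in> ?K" using assms by (intro Inf_nat_def1) auto
  then obtain U where "subspace U" "U \<subseteq> A" "submodular_rank f A = f U + (dim A - dim U)"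
    unfolding submodular_rank_def by auto
  then show thesis using that[of U] dim_subset[of U A] by simp
qed

lemma submodular_rank_le_dim:
  assumes "f {0} = 0" "subspace A"
  shows "submodular_rank f A \<le> dim A"
  using submodular_rank_le[of "{0}" A f] assms subspace_0[of A] by simp

text \<open>A minimiser for one space yields candidates for another by intersection and sum;
  modularity of \<open>dim\<close> makes the dimension terms balance.\<close>

lemma q_matroid_submodular_rank:
  assumes zero: "f {0} = 0"
    and mono: "\<And>A B. subspace A \<Longrightarrow> subspace B \<Longrightarrow> A \<subseteq> B \<Longrightarrow> f A \<le> f B"
    and submod: "\<And>A B. subspace A \<Longrightarrow> subspace B \<Longrightarrow>
      f {a + b | a b. a \<in> A \<and> b \<in> B} + f (A \<inter> B) \<le> f A + f B"
  shows "q_matroid scale (submodular_rank f)"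
  unfolding q_matroid_def
proof (intro conjI allI impI)
  show "submodular_rank f A \<le> dim A" if "subspace A" for A
    using zero that by (rule submodular_rank_le_dim)
next
  fix A B assume A: "subspace A" and B: "subspace B" and AB: "A \<subseteq> B"
  obtain U where U: "subspace U" "U \<subseteq> B" "submodular_rank f B + dim U = f U + dim B"
    using submodular_rank_attained[OF B] .
  have UA: "subspace (U \<inter> A)" using U(1) A by (rule subspace_inter)
  have "submodular_rank f A + dim (U \<inter> A) \<le> f (U \<inter> A) + dim A"
    using UA by (intro submodular_rank_le) auto
  moreover have "f (U \<inter> A) \<le> f U" using mono[OF UA U(1)] by blast
  \<comment> \<open>Since \<open>U + A\<close> lies in \<open>B\<close>, the codimension of
    \<open>U \<inter> A\<close> in \<open>A\<close> is at most that of \<open>U\<close> in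
    \<open>B\<close>.\<close>
  moreover have "dim {u + a | u a. u \<in> U \<and> a \<in> A} + dim (U \<inter> A) = dim U + dim A"
    using U(1) A by (rule dim_sums_Int)
  moreover have "dim {u + a | u a. u \<in> U \<and> a \<in> A} \<le> dim B"
    using U(2) AB subspace_add[OF B] by (intro dim_subset) blast
  ultimately show "submodular_rank f A \<le> submodular_rank f B"
    using U(3) by linarith
next
  fix A B assume A: "subspace A" and B: "subspace B"
  obtain U where U: "subspace U" "U \<subseteq> A" "submodular_rank f A + dim U = f U + dim A"
    using submodular_rank_attained[OF A] .
  obtain W where W: "subspace W" "W \<subseteq> B" "submodular_rank f B + dim W = f W + dim B"
    using submodular_rank_attained[OF B] .
  let ?AB = "{a + b | a b. a \<in> A \<and> b \<in> B}" and ?UW = "{u + w | u w. u \<in> U \<and> w \<in> W}"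
  \<comment> \<open>The sum and the intersection of the minimisers \<open>U\<close> and
    \<open>W\<close> serve as candidates for \<open>A + B\<close> and
    \<open>A \<inter> B\<close>.\<close>
  have "submodular_rank f ?AB + dim ?UW \<le> f ?UW + dim ?AB"
    using subspace_sums[OF U(1) W(1)] U(2) W(2) by (intro submodular_rank_le) blast+
  moreover have "submodular_rank f (A \<inter> B) + dim (U \<inter> W) \<le> f (U \<inter> W) + dim (A \<inter> B)"
    using subspace_inter[OF U(1) W(1)] U(2) W(2) by (intro submodular_rank_le) blast+
  moreover note submod[OF U(1) W(1)] dim_sums_Int[OF A B] dim_sums_Int[OF U(1) W(1)]
  ultimately show "submodular_rank f ?AB + submodular_rank f (A \<inter> B)
      \<le> submodular_rank f A + submodular_rank f B"
    using U(3) W(3) by linarith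
qed

text \<open>The candidate \<open>{0}\<close> already gives the value \<open>dim A\<close>, so the
  minimum equals \<open>dim A\<close> iff no candidate \<open>U\<close> goes below it, and
  \<open>U\<close> does so exactly when \<open>f U < dim U\<close>.\<close>

lemma q_independent_submodular_rank_iff:
  assumes "f {0} = 0" and A: "subspace A"
  shows "q_independent scale (submodular_rank f) A \<longleftrightarrow>
    (\<forall>U. subspace U \<longrightarrow> U \<subseteq> A \<longrightarrow> dim U \<le> f U)"
proof
  assume "q_independent scale (submodular_rank f) A"
  then have "submodular_rank f A = dim A"
    by (simp add: q_independent_def)
  then show "\<forall>U. subspace U \<longrightarrow> U \<subseteq> A \<longrightarrow> dim U \<le> f U"
    using submodular_rank_le[of _ A f] by fastforce
next
  assume R: "\<forall>U. subspace U \<longrightarrow> U \<subseteq> A \<longrightarrow> dim U \<le> f U"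
  obtain U where U: "subspace U" "U \<subseteq> A" "submodular_rank f A + dim U = f U + dim A"
    using submodular_rank_attained[OF A] .
  then have "dim A \<le> submodular_rank f A"
    using R by fastforce
  then show "q_independent scale (submodular_rank f) A"
    using submodular_rank_le_dim[of f, OF assms] A by (simp add: q_independent_def)
qed

end

theorem theorem15:
  fixes scale :: "'a::field \<Rightarrow> 'b::ab_group_add \<Rightarrow> 'b"
    and Basis :: "'b set"
    and I :: "'i set"
    and X :: "'i \<Rightarrow> 'b set"
  assumes "finite_dimensional_vector_space scale Basis"
    and "finite I"
    and "\<And>i. i \<in> I \<Longrightarrow> module.subspace scale (X i)"
  shows "\<exists>r. q_matroid scale r \<and>
    {T. partial_q_transversal scale I X T} =
    {A. q_independent scale r A}"
proof -
  interpret finite_dimensional_vector_space scale Basis by fact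
  let ?f = "\<lambda>U. card {i \<in> I. \<not> U \<subseteq> X i}"
  have zero: "?f {0} = 0"
    using assms(3) subspace_0 by (subst card_eq_0_iff) auto
  have "q_matroid scale (submodular_rank ?f)"
  proof (rule q_matroid_submodular_rank)
    show "?f A \<le> ?f B" if "A \<subseteq> B" for A B
      using that assms(2) by (intro card_mono) auto
    show "?f {a + b | a b. a \<in> A \<and> b \<in> B} + ?f (A \<inter> B) \<le> ?f A + ?f B"
      if "subspace A" "subspace B" for A B
      using assms(2,3) that by (rule card_not_subset_submodular)
  qed (rule zero)
  moreover have "partial_q_transversal scale I X T \<longleftrightarrow> q_independent scale (submodular_rank ?f) T"
    for T
  \<comment> \<open>Both predicates include being a subspace, so other sets \<open>T\<close> satisfy
    neither.\<close>
  proof (cases "subspace T")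
    case True
    have "partial_q_transversal scale I X T \<longleftrightarrow>
        (\<forall>U. subspace U \<longrightarrow> U \<subseteq> T \<longrightarrow> dim U \<le> ?f U)"
      using assms(2,3) True by (rule partial_q_transversal_iff)
    then show ?thesis
      by (simp only: q_independent_submodular_rank_iff[of ?f, OF zero True])
  qed (simp add: partial_q_transversal_def q_independent_def)
  ultimately show ?thesis by blast
qed

end
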